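(* For any field $K$ and any injective ring homomorphisms $\phi_1:\mathbb{Z}[\beta,\gamma,\beta^{-1},(1-\beta)^{-1}]\hookrightarrow K$ and $\phi_2:\mathbb{Z}[x,y]\hookrightarrow K$, one has $$\phi_1\circ\hat\theta\neq\phi_2\circ\hat T$$ as maps from the set $\mathcal{G}$ of isomorphism classes of finite graphs (loops and multiple edges allowed) to $K$.
   Context: Graphs are finite undirected multigraphs; loops and multiple edges are allowed. The degree of a vertex is the number of edge-ends at it (a loop counts twice). A subset $s\subset E$ is identified with the spanning subgraph $(V,s)$, and $d_i(s)$ is the degree of vertex $i$ in $(V,s)$. $k(G)$ is the number of connected components of $G$; $r(G)=|V|-k(G)$ is the rank and $n(G)=|E|-|V|+k(G)$ the nullity; $k(s),r(s),n(s)$ refer to $(V,s)$. The polynomials $f_n(x)$, $n\ge 0$, are defined by $f_0(x)=1$, $f_1(x)=0$, $f_{n+1}(x)=x f_n(x)+f_{n-1}(x)$ for $n\ge1$. For $G=(V,E)$ put $\theta_G(\beta,\gamma):=\sum_{s\subset E}\beta^{|s|}\prod_{i\in V}f_{d_i(s)}(\gamma)$ and define $\hat\theta:\mathcal{G}\to\mathbb{Z}[\beta,\gamma,\beta^{-1},(1-\beta)^{-1}]$ by $$\hat\theta_G(\beta,\gamma):=(1-\beta)^{-|E|+|V|}\beta^{-|V|}\theta_G(\beta,\gamma).$$ The Tutte polynomial is $T_G(x,y):=\sum_{s\subset E}(x-1)^{r(G)-r(s)}(y-1)^{n(s)}$, and $\hat T:\mathcal{G}\to\mathbb{Z}[x,y]$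 is defined by $\hat T_G(x,y):=(x-1)^{k(G)}T_G(x,y)$. Here $\beta,\gamma,x,y$ are indeterminates. *)

theory Defs
  imports
    "HOL-Algebra.Algebraic_Closure_Type"
    "HOL-Algebra.Generated_Rings"
    "HOL-Library.Multiset"
begin

section \<open>Finite multigraphs\<close>

text \<open>An edge carries the multiset of its two ends, so a loop at \<open>v\<close> has ends \<open>{#v, v#}\<close>.\<close>

record ('v, 'e) multigraph =
  verts :: "'v set"
  edges :: "'e set"
  ends  :: "'e \<Rightarrow> 'v multiset"

definition fin_multigraph :: "('v, 'e) multigraph \<Rightarrow> bool" where
  "fin_multigraph G \<longleftrightarrow> finite (verts G) \<and> finite (edges G) \<and>
     (\<forall>e\<in>edges G. size (ends G e) = 2 \<and> set_mset (ends G e) \<subseteq> verts G)"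

definition is_graph_iso ::
  "('v, 'e) multigraph \<Rightarrow> ('w, 'f) multigraph \<Rightarrow> ('v \<Rightarrow> 'w) \<Rightarrow> ('e \<Rightarrow> 'f) \<Rightarrow> bool" where
  "is_graph_iso G H f g \<longleftrightarrow>
     bij_betw f (verts G) (verts H) \<and> bij_betw g (edges G) (edges H) \<and>
     (\<forall>e\<in>edges G. ends H (g e) = image_mset f (ends G e))"

definition deg :: "('v, 'e) multigraph \<Rightarrow> 'e set \<Rightarrow> 'v \<Rightarrow> nat" where
  "deg G s i = (\<Sum>e\<in>s. count (ends G e) i)"

definition adj :: "('v, 'e) multigraph \<Rightarrow> 'e set \<Rightarrow> ('v \<times> 'v) set" where
  "adj G s = {(u, v). \<exists>e\<in>s. ends G e = {#u, v#}}"

definition conn :: "('v, 'e) multigraph \<Rightarrow> 'e set \<Rightarrow> ('v \<times> 'v) set" where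
  "conn G s = (adj G s)\<^sup>* \<inter> verts G \<times> verts G"

text \<open>
  For \<open>s \<subseteq> edges G\<close>, the numbers \<open>comps G s\<close>, \<open>rank G s\<close>, \<open>nullity G s\<close> are \<open>k(s)\<close>, \<open>r(s)\<close>, \<open>n(s)\<close>
  of the spanning subgraph \<open>(V, s)\<close>; those of \<open>G\<close> itself are obtained for \<open>s = edges G\<close>.
  The natural-number subtractions below, and \<open>r(G) - r(s)\<close> in the Tutte polynomial, never
  truncate, since \<open>k(G) \<le> k(s) \<le> |V| \<le> |s| + k(s)\<close>.
\<close>

definition comps :: "('v, 'e) multigraph \<Rightarrow> 'e set \<Rightarrow> nat" where
  "comps G s = card (verts G // conn G s)"

definition rank :: "('v, 'e) multigraph \<Rightarrow> 'e set \<Rightarrow> nat" where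
  "rank G s = card (verts G) - comps G s"

definition nullity :: "('v, 'e) multigraph \<Rightarrow> 'e set \<Rightarrow> nat" where
  "nullity G s = card s + comps G s - card (verts G)"


section \<open>The polynomials\<close>

text \<open>The recursion \<open>f\<^sub>n\<^sub>+\<^sub>1 = x f\<^sub>n + f\<^sub>n\<^sub>-\<^sub>1\<close> is imposed only for \<open>n \<ge> 1\<close>.\<close>

fun f_pol :: "nat \<Rightarrow> 'a::comm_ring_1 \<Rightarrow> 'a" where
  "f_pol 0 x = 1"
| "f_pol (Suc 0) x = 0"
| "f_pol (Suc (Suc n)) x = x * f_pol (Suc n) x + f_pol n x"

definition theta :: "('v, 'e) multigraph \<Rightarrow> 'a::comm_ring_1 \<Rightarrow> 'a \<Rightarrow> 'a" where
  "theta G b c = (\<Sum>s\<in>Pow (edges G). b ^ card s * (\<Prod>i\<in>verts G. f_pol (deg G s i) c))"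

definition tutte :: "('v, 'e) multigraph \<Rightarrow> 'a::comm_ring_1 \<Rightarrow> 'a \<Rightarrow> 'a" where
  "tutte G x y = (\<Sum>s\<in>Pow (edges G).
     (x - 1) ^ (rank G (edges G) - rank G s) * (y - 1) ^ nullity G s)"


section \<open>Invariance under isomorphism\<close>

lemma is_graph_iso_refl: "is_graph_iso G G id id"
  by (simp add: is_graph_iso_def)

lemma is_graph_iso_sym:
  assumes "fin_multigraph G" "is_graph_iso G H f g"
  shows "is_graph_iso H G (inv_into (verts G) f) (inv_into (edges G) g)"
proof -
  have bf: "bij_betw f (verts G) (verts H)" and bg: "bij_betw g (edges G) (edges H)"
    using assms(2) by (auto simp: is_graph_iso_def)
  have "ends G (inv_into (edges G) g e) = image_mset (inv_into (verts G) f) (ends H e)"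
    if e: "e \<in> edges H" for e
  proof -
    let ?e = "inv_into (edges G) g e"
    have e': "?e \<in> edges G" "g ?e = e"
      using bg e by (auto simp: bij_betw_def f_inv_into_f inv_into_into)
    have "ends H e = image_mset f (ends G ?e)"
      using assms(2) e' by (metis is_graph_iso_def)
    then have "image_mset (inv_into (verts G) f) (ends H e)
        = image_mset (\<lambda>v. inv_into (verts G) f (f v)) (ends G ?e)"
      by (simp add: image_mset.compositionality comp_def)
    also have "\<dots> = image_mset (\<lambda>v. v) (ends G ?e)"
      using assms(1) e' bf
      by (intro image_mset_cong) (auto simp: fin_multigraph_def bij_betw_def subset_iff)
    finally show ?thesis by simp
  qed
  then show ?thesis
    using bf bg by (simp add: is_graph_iso_def bij_betw_inv_into)
qed

lemma is_graph_iso_trans: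
  assumes "is_graph_iso G H f g" "is_graph_iso H K f' g'"
  shows "is_graph_iso G K (f' \<circ> f) (g' \<circ> g)"
proof -
  have "g e \<in> edges H" if "e \<in> edges G" for e
    using assms(1) that by (auto simp: is_graph_iso_def bij_betw_def)
  then show ?thesis
    using assms
    by (auto simp: is_graph_iso_def image_mset.compositionality intro: bij_betw_trans)
qed

lemma deg_iso:
  assumes G: "fin_multigraph G" and iso: "is_graph_iso G H f g"
    and s: "s \<subseteq> edges G" and i: "i \<in> verts G"
  shows "deg H (g ` s) (f i) = deg G s i"
proof -
  have inj: "inj_on f (verts G)" and ig: "inj_on g s"
    using iso s by (auto simp: is_graph_iso_def bij_betw_def intro: inj_on_subset)
  have c: "count (ends H (g e)) (f i) = count (ends G e) i" if e: "e \<in> s" for e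
  proof -
    have sub: "set_mset (ends G e) \<subseteq> verts G" and eq: "ends H (g e) = image_mset f (ends G e)"
      using G iso e s by (auto simp: fin_multigraph_def is_graph_iso_def)
    have "f -` {f i} \<inter> set_mset (ends G e) = (if i \<in># ends G e then {i} else {})"
      using inj i sub by (auto simp: inj_on_def subset_iff)
    then show ?thesis
      by (auto simp: eq count_image_mset not_in_iff)
  qed
  then show ?thesis
    by (simp add: deg_def sum.reindex[OF ig])
qed

lemma conn_iso:
  assumes G: "fin_multigraph G" and iso: "is_graph_iso G H f g"
    and s: "s \<subseteq> edges G" and u: "u \<in> verts G"
  shows "conn H (g ` s) `` {f u} = f ` (conn G s `` {u})"
proof -
  have inj: "inj_on f (verts G)" and im: "f ` verts G = verts H"
    using iso by (auto simp: is_graph_iso_def bij_betw_def)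
  have ends: "ends H (g e) = image_mset f (ends G e)" "set_mset (ends G e) \<subseteq> verts G"
    "size (ends G e) = 2" if "e \<in> s" for e
    using G iso that s by (auto simp: fin_multigraph_def is_graph_iso_def)
  have fwd: "(f u, f v) \<in> (adj H (g ` s))\<^sup>*" if "(u, v) \<in> (adj G s)\<^sup>*" for v
    using that
  proof induction
    case (step v w)
    then obtain e where "e \<in> s" "ends G e = {#v, w#}" by (auto simp: adj_def)
    then have "(f v, f w) \<in> adj H (g ` s)"
      using ends(1) by (fastforce simp: adj_def)
    then show ?case using step by (meson rtrancl.rtrancl_into_rtrancl)
  qed simp
  have bwd: "\<exists>v\<in>verts G. w = f v \<and> (u, v) \<in> (adj G s)\<^sup>*" if "(f u, w) \<in> (adj H (g ` s))\<^sup>*" for w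
    using that
  proof induction
    case base
    then show ?case using u by auto
  next
    case (step w w')
    then obtain v where v: "v \<in> verts G" "w = f v" "(u, v) \<in> (adj G s)\<^sup>*" by auto
    from step obtain e where e: "e \<in> s" "ends H (g e) = {#w, w'#}" by (auto simp: adj_def)
    obtain a b where ab: "ends G e = {#a, b#}"
    proof -
      obtain a M where M: "ends G e = add_mset a M"
        using ends(3)[OF e(1)] by (cases "ends G e") auto
      then have "size M = 1" using ends(3)[OF e(1)] by simp
      then obtain b where "M = {#b#}" by (blast dest: size_1_singleton_mset)
      then show thesis using that M by simp
    qed
    have mem: "a \<in> verts G" "b \<in> verts G" using ends(2)[OF e(1)] ab by auto
    have "{#f a, f b#} = {#f v, w'#}" using ends(1)[OF e(1)] e ab v by simp
    then consider "f a = f v" "f b = w'" | "f b = f v" "f a = w'"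
      by (auto simp: add_eq_conv_ex)
    then show ?case
    proof cases
      case 1
      then have "a = v" using inj mem v by (auto simp: inj_on_def)
      then have "(v, b) \<in> adj G s" using ab e by (auto simp: adj_def)
      with v(3) have "(u, b) \<in> (adj G s)\<^sup>*" by (rule rtrancl.rtrancl_into_rtrancl)
      then show ?thesis using 1 mem by blast
    next
      case 2
      then have "b = v" using inj mem v by (auto simp: inj_on_def)
      then have "(v, a) \<in> adj G s" using ab e by (auto simp: adj_def add_mset_commute)
      with v(3) have "(u, a) \<in> (adj G s)\<^sup>*" by (rule rtrancl.rtrancl_into_rtrancl)
      then show ?thesis using 2 mem by blast
    qed
  qed
  show ?thesis
    using fwd bwd u im by (fastforce simp: conn_def)
qed

lemma comps_iso:
  assumes G: "fin_multigraph G" and iso: "is_graph_iso G H f g" and s: "s \<subseteq> edges G"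
  shows "comps H (g ` s) = comps G s"
proof -
  have inj: "inj_on f (verts G)" and im: "verts H = f ` verts G"
    using iso by (auto simp: is_graph_iso_def bij_betw_def)
  have "verts H // conn H (g ` s) = (`) f ` (verts G // conn G s)"
    using conn_iso[OF G iso s] by (auto simp: quotient_def im)
  moreover have "inj_on ((`) f) (verts G // conn G s)"
  proof (rule inj_on_subset)
    show "inj_on ((`) f) (Pow (verts G))" using inj by (rule inj_on_image_Pow)
    show "verts G // conn G s \<subseteq> Pow (verts G)" by (auto simp: quotient_def conn_def)
  qed
  ultimately show ?thesis by (simp add: comps_def card_image)
qed

lemma card_iso:
  assumes "is_graph_iso G H f g"
  shows "card (verts H) = card (verts G)" "card (edges H) = card (edges G)"
  using assms by (auto simp: is_graph_iso_def dest: bij_betw_same_card)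

lemma sum_Pow_edges_iso:
  assumes "is_graph_iso G H f g"
  shows "(\<Sum>s\<in>Pow (edges H). F s) = (\<Sum>s\<in>Pow (edges G). F (g ` s))"
proof -
  have "bij_betw ((`) g) (Pow (edges G)) (Pow (edges H))"
    using assms by (intro bij_betw_Pow) (simp add: is_graph_iso_def)
  then show ?thesis by (rule sum.reindex_bij_betw[symmetric])
qed

lemma theta_iso:
  assumes G: "fin_multigraph G" and iso: "is_graph_iso G H f g"
  shows "theta H b c = theta G b c"
proof -
  have bf: "bij_betw f (verts G) (verts H)" and ig: "inj_on g (edges G)"
    using iso by (auto simp: is_graph_iso_def bij_betw_def)
  show ?thesis
    unfolding theta_def sum_Pow_edges_iso[OF iso]
  proof (rule sum.cong[OF refl])
    fix s assume "s \<in> Pow (edges G)"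
    then have s: "s \<subseteq> edges G" by simp
    have "(\<Prod>i\<in>verts H. f_pol (deg H (g ` s) i) c) = (\<Prod>i\<in>verts G. f_pol (deg H (g ` s) (f i)) c)"
      using bf by (rule prod.reindex_bij_betw[symmetric])
    also have "\<dots> = (\<Prod>i\<in>verts G. f_pol (deg G s i) c)"
      by (intro prod.cong refl) (simp add: deg_iso[OF G iso s])
    finally show "b ^ card (g ` s) * (\<Prod>i\<in>verts H. f_pol (deg H (g ` s) i) c)
        = b ^ card s * (\<Prod>i\<in>verts G. f_pol (deg G s i) c)"
      using ig s by (simp add: card_image inj_on_subset)
  qed
qed

lemma tutte_iso:
  assumes G: "fin_multigraph G" and iso: "is_graph_iso G H f g"
  shows "tutte H x y = tutte G x y"
proof -
  have ig: "inj_on g (edges G)" and im: "edges H = g ` edges G"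
    using iso by (auto simp: is_graph_iso_def bij_betw_def)
  show ?thesis
    unfolding tutte_def sum_Pow_edges_iso[OF iso]
    using ig
    by (intro sum.cong refl)
      (auto simp: rank_def nullity_def im comps_iso[OF G iso] card_iso[OF iso] card_image inj_on_subset)
qed


section \<open>Isomorphism classes\<close>

text \<open>
  Every finite multigraph is isomorphic to one whose vertices and edges are natural numbers.
\<close>

definition graph_equiv :: "(nat, nat) multigraph \<Rightarrow> (nat, nat) multigraph \<Rightarrow> bool" where
  "graph_equiv G H \<longleftrightarrow> fin_multigraph G \<and> fin_multigraph H \<and> (\<exists>f g. is_graph_iso G H f g)"

quotient_type graph_class = "(nat, nat) multigraph" / partial: graph_equiv
proof (rule part_equivpI)
  have "fin_multigraph \<lparr>verts = {}, edges = {}, ends = \<lambda>_. {#}\<rparr>"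
    by (simp add: fin_multigraph_def)
  then show "\<exists>G. graph_equiv G G"
    using is_graph_iso_refl unfolding graph_equiv_def by blast
  show "symp graph_equiv"
    by (rule sympI) (meson graph_equiv_def is_graph_iso_sym)
  show "transp graph_equiv"
    by (rule transpI) (meson graph_equiv_def is_graph_iso_trans)
qed


section \<open>The rings and the normalised invariants\<close>

text \<open>
  The elements of \<^typ>\<open>int poly poly\<close> are polynomials over \<open>\<int>\<close> in two indeterminates, namely
  the outer variable \<open>[:0, 1:]\<close> and the inner one \<open>[:[:0, 1:]:]\<close>.
\<close>

definition Z_xy :: "int poly poly ring" where
  "Z_xy = ring_of_type_algebra"

definition x_var :: "int poly poly" where "x_var = [:0, 1:]"
definition y_var :: "int poly poly" where "y_var = [:[:0, 1:]:]"

definition \<beta> :: "int poly poly fract" where "\<beta> = to_fract [:0, 1:]"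
definition \<gamma> :: "int poly poly fract" where "\<gamma> = to_fract [:[:0, 1:]:]"

text \<open>
  The ring \<open>\<int>[\<beta>, \<gamma>, \<beta>\<^sup>-\<^sup>1, (1 - \<beta>)\<^sup>-\<^sup>1]\<close>, as a subring of the field of fractions of \<open>\<int>[\<beta>, \<gamma>]\<close>.
\<close>

definition Z_bg_loc :: "int poly poly fract ring" where
  "Z_bg_loc = ring_of_type_algebra
     \<lparr>carrier := generate_ring ring_of_type_algebra {\<beta>, \<gamma>, inverse \<beta>, inverse (1 - \<beta>)}\<rparr>"

lift_definition theta_hat :: "graph_class \<Rightarrow> int poly poly fract" is
  "\<lambda>G. (1 - \<beta>) powi (- int (card (edges G)) + int (card (verts G)))
       * \<beta> powi (- int (card (verts G))) * theta G \<beta> \<gamma>"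
  by (auto simp: graph_equiv_def theta_iso card_iso)

lift_definition tutte_hat :: "graph_class \<Rightarrow> int poly poly" is
  "\<lambda>G. (x_var - 1) ^ comps G (edges G) * tutte G x_var y_var"
proof -
  fix G H assume "graph_equiv G H"
  then obtain f g where G: "fin_multigraph G" and iso: "is_graph_iso G H f g"
    by (auto simp: graph_equiv_def)
  have "edges H = g ` edges G"
    using iso by (auto simp: is_graph_iso_def bij_betw_def)
  then show "(x_var - 1) ^ comps G (edges G) * tutte G x_var y_var = (x_var - 1) ^ comps H (edges H) * tutte H x_var y_var"
    by (simp add: comps_iso[OF G iso] tutte_iso[OF G iso])
qed

lemma ring_Z_bg_loc: "ring Z_bg_loc"
  unfolding Z_bg_loc_def
  by (intro ring.generate_ring_is_ring ring_from_type_algebra)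
    (simp add: ring_of_type_algebra_def)

lemma beta_nonzero: "\<beta> \<noteq> 0" "1 - \<beta> \<noteq> 0"
proof -
  show "\<beta> \<noteq> 0" by (simp add: \<beta>_def)
  have "1 - \<beta> = to_fract (1 - [:0, 1:])" by (simp only: \<beta>_def to_fract_diff to_fract_1)
  then show "1 - \<beta> \<noteq> 0" by (simp add: one_pCons)
qed

lemma Z_bg_loc_ops [simp]:
  "x \<otimes>\<^bsub>Z_bg_loc\<^esub> y = x * y" "x \<oplus>\<^bsub>Z_bg_loc\<^esub> y = x + y" "\<one>\<^bsub>Z_bg_loc\<^esub> = 1" "\<zero>\<^bsub>Z_bg_loc\<^esub> = 0"
  by (simp_all add: Z_bg_loc_def ring_of_type_algebra_def)

lemma Z_bg_loc_gens:
  "{\<beta>, \<gamma>, inverse \<beta>, inverse (1 - \<beta>)} \<subseteq> carrier Z_bg_loc"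
  by (auto simp: Z_bg_loc_def intro: generate_ring.incl)

lemma Z_bg_loc_closed:
  shows Z_bg_loc_0: "0 \<in> carrier Z_bg_loc" and Z_bg_loc_1: "1 \<in> carrier Z_bg_loc"
    and Z_bg_loc_add: "\<And>x y. x \<in> carrier Z_bg_loc \<Longrightarrow> y \<in> carrier Z_bg_loc \<Longrightarrow> x + y \<in> carrier Z_bg_loc"
    and Z_bg_loc_mult: "\<And>x y. x \<in> carrier Z_bg_loc \<Longrightarrow> y \<in> carrier Z_bg_loc \<Longrightarrow> x * y \<in> carrier Z_bg_loc"
    and Z_bg_loc_uminus: "\<And>x. x \<in> carrier Z_bg_loc \<Longrightarrow> - x \<in> carrier Z_bg_loc"
proof -
  interpret ring Z_bg_loc by (rule ring_Z_bg_loc)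
  show "0 \<in> carrier Z_bg_loc" using zero_closed by simp
  show "1 \<in> carrier Z_bg_loc" using one_closed by simp
  show "x + y \<in> carrier Z_bg_loc" if "x \<in> carrier Z_bg_loc" "y \<in> carrier Z_bg_loc" for x y
    using add.m_closed[OF that] by simp
  show "x * y \<in> carrier Z_bg_loc" if "x \<in> carrier Z_bg_loc" "y \<in> carrier Z_bg_loc" for x y
    using m_closed[OF that] by simp
  show "- x \<in> carrier Z_bg_loc" if x: "x \<in> carrier Z_bg_loc" for x
  proof -
    have "x + \<ominus>\<^bsub>Z_bg_loc\<^esub> x = 0" using r_neg[OF x] by simp
    then have "\<ominus>\<^bsub>Z_bg_loc\<^esub> x = - x" by (simp add: add_eq_0_iff)
    then show ?thesis using a_inv_closed[OF x] by simp
  qed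
qed

lemma Z_bg_loc_power: "x \<in> carrier Z_bg_loc \<Longrightarrow> x ^ n \<in> carrier Z_bg_loc"
  by (induction n) (auto intro: Z_bg_loc_closed)

lemma Z_bg_loc_powi:
  "x \<in> carrier Z_bg_loc \<Longrightarrow> inverse x \<in> carrier Z_bg_loc \<Longrightarrow> x powi n \<in> carrier Z_bg_loc"
  by (auto simp: power_int_def intro: Z_bg_loc_power)

lemma Z_bg_loc_f_pol: "x \<in> carrier Z_bg_loc \<Longrightarrow> f_pol n x \<in> carrier Z_bg_loc"
  by (induction n x rule: f_pol.induct) (auto intro: Z_bg_loc_closed)

lemma Z_bg_loc_sum: "(\<And>i. i \<in> A \<Longrightarrow> F i \<in> carrier Z_bg_loc) \<Longrightarrow> sum F A \<in> carrier Z_bg_loc"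
  by (induction A rule: infinite_finite_induct) (auto intro: Z_bg_loc_closed)

lemma Z_bg_loc_prod: "(\<And>i. i \<in> A \<Longrightarrow> F i \<in> carrier Z_bg_loc) \<Longrightarrow> prod F A \<in> carrier Z_bg_loc"
  by (induction A rule: infinite_finite_induct) (auto intro: Z_bg_loc_closed)

lemma theta_hat_in_carrier: "theta_hat C \<in> carrier Z_bg_loc"
proof transfer
  fix G :: "(nat, nat) multigraph"
  have g: "\<beta> \<in> carrier Z_bg_loc" "\<gamma> \<in> carrier Z_bg_loc" "inverse \<beta> \<in> carrier Z_bg_loc"
    "inverse (1 - \<beta>) \<in> carrier Z_bg_loc"
    using Z_bg_loc_gens by auto
  have "1 - \<beta> \<in> carrier Z_bg_loc"
    using Z_bg_loc_add[OF Z_bg_loc_1 Z_bg_loc_uminus[OF g(1)]] by simp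
  then show "(1 - \<beta>) powi (- int (card (edges G)) + int (card (verts G)))
       * \<beta> powi (- int (card (verts G))) * theta G \<beta> \<gamma> \<in> carrier Z_bg_loc"
    unfolding theta_def
    by (intro Z_bg_loc_mult Z_bg_loc_powi Z_bg_loc_sum Z_bg_loc_prod Z_bg_loc_power Z_bg_loc_f_pol g)
qed

end

theory Submission
  imports Defs
begin

text \<open>
  Two graphs separate the invariants. Let \<open>P\<close> be a single vertex and \<open>L\<close> a single vertex with one
  loop. A loop contributes degree \<open>2\<close>, and \<open>f\<^sub>2 = 1\<close>, so \<open>\<theta>\<close> takes the values \<open>1\<close> on \<open>P\<close>
  and \<open>1 + \<beta>\<close> on \<open>L\<close>. Hence \<open>\<theta>\<close>-hat is \<open>(1 - \<beta>) / \<beta>\<close> on \<open>P\<close> and \<open>(1 + \<beta>) / \<beta>\<close> on \<open>L\<close>: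
  the two values differ by the integer \<open>2\<close>, which every ring homomorphism respects. On the other
  side, \<open>T\<close>-hat is \<open>x - 1\<close> on \<open>P\<close> and \<open>(x - 1) y\<close> on \<open>L\<close>.

  If the two maps into \<open>K\<close> agreed, then \<open>\<phi>\<^sub>2\<close> would identify \<open>(x - 1) y\<close> with \<open>(x - 1) + 2\<close>, and by
  its injectivity \<open>(x - 1) (y - 1) = 2\<close> would hold in \<open>\<int>[x, y]\<close>, which is absurd. In other words,
  agreement would force the Tutte variables onto the Ising hyperbola \<open>(x - 1) (y - 1) = 2\<close>.
\<close>

definition bouquet :: "nat set \<Rightarrow> (nat, nat) multigraph" where
  "bouquet E = \<lparr>verts = {0}, edges = E, ends = \<lambda>_. {#0, 0#}\<rparr>"

lemma graph_equiv_bouquet: "finite E \<Longrightarrow> graph_equiv (bouquet E) (bouquet E)"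
  using is_graph_iso_refl by (auto simp: graph_equiv_def fin_multigraph_def bouquet_def)

lemma comps_bouquet: "comps (bouquet E) s = 1"
proof -
  have "conn (bouquet E) s = {(0, 0)}"
    by (auto simp: conn_def bouquet_def)
  then show ?thesis
    by (simp add: comps_def quotient_def bouquet_def)
qed

lemma theta_hat_bouquet:
  assumes "finite E"
  shows "theta_hat (abs_graph_class (bouquet E)) =
    (1 - \<beta>) powi (1 - int (card E)) / \<beta> * theta (bouquet E) \<beta> \<gamma>"
  using theta_hat.abs_eq[OF graph_equiv_bouquet[OF assms]]
  by (simp add: bouquet_def power_int_minus divide_inverse)

lemma theta_hat_vertex: "theta_hat (abs_graph_class (bouquet {})) = (1 - \<beta>) / \<beta>"
  by (simp add: theta_hat_bouquet) (simp add: theta_def bouquet_def deg_def)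

lemma theta_hat_loop: "theta_hat (abs_graph_class (bouquet {0})) = (1 + \<beta>) / \<beta>"
proof -
  have "theta (bouquet {0}) \<beta> \<gamma> = 1 + \<beta>"
    by (simp add: theta_def bouquet_def deg_def Pow_insert numeral_2_eq_2)
  then show ?thesis by (simp add: theta_hat_bouquet)
qed

lemma tutte_hat_bouquet:
  assumes "finite E"
  shows "tutte_hat (abs_graph_class (bouquet E)) =
    (x_var - 1) * (\<Sum>s\<in>Pow E. (y_var - 1) ^ card s)"
proof -
  have "tutte (bouquet E) x_var y_var = (\<Sum>s\<in>Pow E. (y_var - 1) ^ card s)"
    by (simp add: tutte_def rank_def nullity_def comps_bouquet) (simp add: bouquet_def)
  then show ?thesis
    using tutte_hat.abs_eq[OF graph_equiv_bouquet[OF assms]] by (simp add: comps_bouquet)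
qed

lemma tutte_hat_vertex: "tutte_hat (abs_graph_class (bouquet {})) = x_var - 1"
  by (simp add: tutte_hat_bouquet)

lemma tutte_hat_loop: "tutte_hat (abs_graph_class (bouquet {0})) = (x_var - 1) * y_var"
  by (simp add: tutte_hat_bouquet Pow_insert)

theorem mainTheorem11:
  fixes K :: "('k, 'm) ring_scheme"
    and \<phi>\<^sub>1 :: "int poly poly fract \<Rightarrow> 'k"
    and \<phi>\<^sub>2 :: "int poly poly \<Rightarrow> 'k"
  assumes "field K"
    and "\<phi>\<^sub>1 \<in> ring_hom Z_bg_loc K" and "inj_on \<phi>\<^sub>1 (carrier Z_bg_loc)"
    and "\<phi>\<^sub>2 \<in> ring_hom Z_xy K" and "inj_on \<phi>\<^sub>2 (carrier Z_xy)"
  shows "\<phi>\<^sub>1 \<circ> theta_hat \<noteq> \<phi>\<^sub>2 \<circ> tutte_hat"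
proof
  assume agree: "\<phi>\<^sub>1 \<circ> theta_hat = \<phi>\<^sub>2 \<circ> tutte_hat"
  let ?P = "abs_graph_class (bouquet {})" and ?L = "abs_graph_class (bouquet {0})"
  have agree': "\<phi>\<^sub>1 (theta_hat C) = \<phi>\<^sub>2 (tutte_hat C)" for C
    using fun_cong[OF agree, of C] by simp
  \<comment> \<open>The constant is kept as \<open>1 + 1\<close>: the homomorphism laws move it into \<open>K\<close>, which has no numerals.\<close>
  have theta: "theta_hat ?L = theta_hat ?P + (1 + 1)"
    unfolding theta_hat_vertex theta_hat_loop using beta_nonzero(1) by (simp add: field_simps)
  have hom1: "\<phi>\<^sub>1 (theta_hat ?P + (1 + 1)) = \<phi>\<^sub>1 (theta_hat ?P) \<oplus>\<^bsub>K\<^esub> (\<one>\<^bsub>K\<^esub> \<oplus>\<^bsub>K\<^esub> \<one>\<^bsub>K\<^esub>)"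
    by (simp only: theta_hat_in_carrier Z_bg_loc_closed
        ring_hom_add[OF assms(2), unfolded Z_bg_loc_ops]
        ring_hom_one[OF assms(2), unfolded Z_bg_loc_ops])
  have Z_xy: "carrier Z_xy = UNIV" "\<And>p q. p \<oplus>\<^bsub>Z_xy\<^esub> q = p + q" "\<one>\<^bsub>Z_xy\<^esub> = 1"
    by (simp_all add: Z_xy_def ring_of_type_algebra_def)
  have hom2: "\<phi>\<^sub>2 (p + (1 + 1)) = \<phi>\<^sub>2 p \<oplus>\<^bsub>K\<^esub> (\<one>\<^bsub>K\<^esub> \<oplus>\<^bsub>K\<^esub> \<one>\<^bsub>K\<^esub>)" for p
    by (simp only: UNIV_I ring_hom_add[OF assms(4), unfolded Z_xy]
        ring_hom_one[OF assms(4), unfolded Z_xy])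
  have "\<phi>\<^sub>2 (tutte_hat ?L) = \<phi>\<^sub>1 (theta_hat ?P + (1 + 1))"
    by (simp only: agree'[symmetric] theta)
  also have "\<dots> = \<phi>\<^sub>2 (tutte_hat ?P + (1 + 1))"
    by (simp only: hom1 hom2 agree')
  finally have "tutte_hat ?L = tutte_hat ?P + (1 + 1)"
    using assms(5) by (simp add: Z_xy inj_eq)
  then have *: "(x_var - 1) * y_var = x_var - 1 + (1 + 1)"
    by (simp only: tutte_hat_vertex tutte_hat_loop)
  \<comment> \<open>At \<open>x = 1\<close> the equation reads \<open>0 = 2\<close>.\<close>
  have "poly ((x_var - 1) * y_var) 1 = poly (x_var - 1 + (1 + 1)) 1"
    by (simp only: *)
  then show False
    by (simp add: x_var_def)
qed

end
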